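(* For every $n\ge 1$, the number of edges of the tilde-hypercube $\tilde Q_n$ of order $n$ satisfies $4\,|E(\tilde Q_n)|=(3n-1)\,2^{n}$, i.e. $|E(\tilde Q_n)|=(3n-1)\cdot 2^{n-2}$.
   Context: For binary words $u,v$ of equal length, the tilde-distance $\mathrm{dist}_\sim(u,v)$ is the minimum number of replacements (changing the symbol in one position to the opposite symbol) and swaps (exchanging two adjacent different symbols) needed to transform $u$ into $v$. The tilde-hypercube $\tilde Q_n$ of order $n\ge1$ is the (simple, undirected) graph whose vertices are the $2^n$ binary words of length $n$, two vertices being adjacent exactly when their tilde-distance is $1$. $E(G)$ denotes the edge set of a graph $G$. *)

theory Defs
  imports Complex_Main
begin

record 'a ugraph =
  vertices :: "'a set"
  edges :: "'a set set"

definition simple_ugraph :: "'a ugraph \<Rightarrow> bool" where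
  "simple_ugraph G \<longleftrightarrow> (\<forall>e \<in> edges G. e \<subseteq> vertices G \<and> card e = 2)"

type_synonym word = "bool list"

inductive replacement :: "word \<Rightarrow> word \<Rightarrow> bool" where
  "i < length u \<Longrightarrow> replacement u (u[i := \<not> u ! i])"

inductive swap :: "word \<Rightarrow> word \<Rightarrow> bool" where
  "Suc i < length u \<Longrightarrow> u ! i \<noteq> u ! Suc i
    \<Longrightarrow> swap u (u[i := u ! Suc i, Suc i := u ! i])"

definition tilde_step :: "word \<Rightarrow> word \<Rightarrow> bool" where
  "tilde_step u v \<longleftrightarrow> replacement u v \<or> swap u v"

text \<open>Only meaningful for words of equal length; there the minimum exists
  by \<open>tilde_dist_steps\<close> below.\<close>

definition tilde_dist :: "word \<Rightarrow> word \<Rightarrow> nat" where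
  "tilde_dist u v = (LEAST k. (tilde_step ^^ k) u v)"

definition tilde_hypercube :: "nat \<Rightarrow> word ugraph" where
  "tilde_hypercube n =
    \<lparr> vertices = {u. length u = n},
      edges = {{u, v} | u v. length u = n \<and> length v = n \<and> tilde_dist u v = 1} \<rparr>"

lemma ex_tilde_steps:
  assumes "length u = length v"
  shows "\<exists>k. (tilde_step ^^ k) u v"
proof -
  have "tilde_step\<^sup>*\<^sup>* u (take j v @ drop j u)" if "j \<le> length u" for j
    using that
  proof (induction j)
    case (Suc j)
    let ?w = "take j v @ drop j u"
    let ?w' = "take (Suc j) v @ drop (Suc j) u"
    have j: "j < length u" "j < length v" using Suc.prems assms by auto
    have w: "?w = take j v @ u ! j # drop (Suc j) u"
      using j by (simp add: Cons_nth_drop_Suc)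
    have w': "?w' = take j v @ v ! j # drop (Suc j) u"
      using j by (simp add: take_Suc_conv_app_nth)
    have "?w = ?w' \<or> tilde_step ?w ?w'"
    proof (cases "u ! j = v ! j")
      case False
      have "replacement ?w (?w[j := \<not> ?w ! j])"
        using j by (intro replacement.intros) simp
      moreover have "?w[j := \<not> ?w ! j] = ?w'"
        using j False unfolding w w' by (simp add: list_update_append nth_append)
      ultimately show ?thesis by (simp add: tilde_step_def)
    qed (simp add: w w')
    moreover have "tilde_step\<^sup>*\<^sup>* u ?w" using Suc by simp
    ultimately show ?case
      using rtranclp.rtrancl_into_rtrancl by metis
  qed simp
  from this[of "length u"] have "tilde_step\<^sup>*\<^sup>* u v" using assms by simp
  then show ?thesis by (simp add: rtranclp_power)
qed

lemma tilde_dist_steps: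
  assumes "length u = length v"
  shows "(tilde_step ^^ tilde_dist u v) u v"
  unfolding tilde_dist_def using ex_tilde_steps[OF assms] by (rule LeastI_ex)

lemma tilde_dist_refl: "tilde_dist u u = 0"
  unfolding tilde_dist_def by (rule Least_eq_0) simp

lemma simple_tilde_hypercube: "simple_ugraph (tilde_hypercube n)"
proof -
  have "u \<noteq> v" if "tilde_dist u v = 1" for u v
    using that tilde_dist_refl by force
  then show ?thesis
    by (fastforce simp: simple_ugraph_def tilde_hypercube_def)
qed

lemma card_vertices_tilde_hypercube: "card (vertices (tilde_hypercube n)) = 2 ^ n"
  using card_lists_length_eq[of "UNIV :: bool set" n] by (simp add: tilde_hypercube_def)

end

theory Submission
  imports Defs
begin

text \<open>
  Split the edges by the first letters of their endpoints. An edge either extends an edge of the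
  hypercube of order one less by a common first letter, or replaces the first letter, or swaps the
  first two letters. Hence \<open>e (n + 2) = 2 * e (n + 1) + 2 ^ (n + 1) + 2 ^ n\<close>,
  which together with \<open>e 1 = 1\<close> gives the formula.
\<close>

lemma replacement_iff: "replacement u v \<longleftrightarrow> (\<exists>i<length u. v = u[i := \<not> u ! i])"
  by (auto simp: replacement.simps)

lemma swap_iff:
  "swap u v \<longleftrightarrow> (\<exists>i. Suc i < length u \<and> u ! i \<noteq> u ! Suc i \<and> v = u[i := u ! Suc i, Suc i := u ! i])"
  by (auto simp: swap.simps)

text \<open>Applied to the position of a step, this separates position 0, where the first letter is
  involved, from positions inside the tail.\<close>

lemma ex_nat_split: "(\<exists>i. P i) \<longleftrightarrow> P 0 \<or> (\<exists>i. P (Suc i))"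
  by (metis not0_implies_Suc)

lemma replacement_Cons_iff:
  "replacement (a # u) w \<longleftrightarrow> w = (\<not> a) # u \<or> (\<exists>v. w = a # v \<and> replacement u v)"
  unfolding replacement_iff by (subst ex_nat_split) auto

lemma swap_Cons_iff:
  "swap (a # u) w \<longleftrightarrow>
    (\<exists>x. u = (\<not> a) # x \<and> w = (\<not> a) # a # x) \<or> (\<exists>v. w = a # v \<and> swap u v)"
  unfolding swap_iff by (subst ex_nat_split) (cases u; auto)

text \<open>The recursion on the first letter behind the edge count: the three disjuncts become the
  families of edges that are counted separately.\<close>

lemma tilde_step_Cons_iff:
  "tilde_step (a # u) w \<longleftrightarrow> w = (\<not> a) # u
    \<or> (\<exists>x. u = (\<not> a) # x \<and> w = (\<not> a) # a # x) \<or> (\<exists>v. w = a # v \<and> tilde_step u v)"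
  by (auto simp: tilde_step_def replacement_Cons_iff swap_Cons_iff)

lemma not_tilde_step_Nil: "\<not> tilde_step [] v"
  by (simp add: tilde_step_def replacement_iff swap_iff)

lemma tilde_step_length: "tilde_step u v \<Longrightarrow> length v = length u"
  by (auto simp: tilde_step_def replacement_iff swap_iff)

lemma tilde_step_irrefl: "\<not> tilde_step u u"
  by (induction u) (auto simp: not_tilde_step_Nil tilde_step_Cons_iff)

text \<open>A single step bounds the least exponent by 1, and exponent 0 would force
  \<open>u = v\<close>, which irreflexivity of \<open>tilde_step\<close> excludes.\<close>

lemma tilde_dist_eq_1_iff:
  assumes "length u = length v"
  shows "tilde_dist u v = 1 \<longleftrightarrow> tilde_step u v"
proof
  assume "tilde_dist u v = 1"
  with tilde_dist_steps[OF assms] show "tilde_step u v" by (simp add: eq_OO)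
next
  assume step: "tilde_step u v"
  then have "tilde_dist u v \<le> 1"
    unfolding tilde_dist_def by (intro Least_le) (simp add: eq_OO)
  moreover have "tilde_dist u v \<noteq> 0"
    using tilde_dist_steps[OF assms] step tilde_step_irrefl by (metis relpowp_0_E)
  ultimately show "tilde_dist u v = 1" by linarith
qed

lemma edges_tilde_hypercube:
  "edges (tilde_hypercube n) = {{u, v} | u v. length u = n \<and> tilde_step u v}"
proof -
  have "length u = n \<and> length v = n \<and> tilde_dist u v = 1 \<longleftrightarrow> length u = n \<and> tilde_step u v"
    for u v
    using tilde_dist_eq_1_iff tilde_step_length by metis
  then show ?thesis by (simp add: tilde_hypercube_def)
qed

lemma edges_tilde_hypercube_0: "edges (tilde_hypercube 0) = {}"
  by (simp add: edges_tilde_hypercube not_tilde_step_Nil)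

text \<open>The last family is indexed by \<open>Suc (length x) = n\<close> instead of
  \<open>length x = n - 1\<close>, so that it is empty for \<open>n = 0\<close>, where there is no
  second letter to swap.\<close>

lemma edges_tilde_hypercube_Suc:
  "edges (tilde_hypercube (Suc n)) =
    (`) (Cons False) ` edges (tilde_hypercube n) \<union> (`) (Cons True) ` edges (tilde_hypercube n)
    \<union> (\<lambda>u. {False # u, True # u}) ` {u. length u = n}
    \<union> (\<lambda>x. {False # True # x, True # False # x}) ` {x. Suc (length x) = n}"
  (is "?L = ?A False \<union> ?A True \<union> ?B \<union> ?C")
proof (intro equalityI subsetI)
  fix e assume "e \<in> ?L"
  then obtain u' w where "e = {u', w}" "length u' = Suc n" "tilde_step u' w"
    unfolding edges_tilde_hypercube by blast
  then obtain a u where e: "e = {a # u, w}" "length u = n" and "tilde_step (a # u) w"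
    by (metis length_Suc_conv)
  then consider "w = (\<not> a) # u" | x where "u = (\<not> a) # x" "w = (\<not> a) # a # x"
    | v where "w = a # v" "tilde_step u v"
    unfolding tilde_step_Cons_iff by blast
  then show "e \<in> ?A False \<union> ?A True \<union> ?B \<union> ?C"
  proof cases
    case 1
    \<comment> \<open>Edges are unordered, so both values of \<open>a\<close> give the same
      pair.\<close>
    with e have "e \<in> ?B" by (cases a) auto
    then show ?thesis by blast
  next
    case 2
    with e have "e \<in> ?C" by (cases a) auto
    then show ?thesis by blast
  next
    case 3
    with e have "{u, v} \<in> edges (tilde_hypercube n)" "e = Cons a ` {u, v}"
      by (auto simp: edges_tilde_hypercube)
    then have "e \<in> ?A a" by blast
    then show ?thesis by (cases a) auto
  qed
next
  fix e assume "e \<in> ?A False \<union> ?A True \<union> ?B \<union> ?C"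
  then consider a e' where "e' \<in> edges (tilde_hypercube n)" "e = Cons a ` e'"
    | u where "length u = n" "e = {False # u, True # u}"
    | x where "Suc (length x) = n" "e = {False # True # x, True # False # x}"
    by blast
  then show "e \<in> ?L"
  proof cases
    case (1 a e')
    then obtain u v where uv: "e' = {u, v}" "length u = n" "tilde_step u v"
      unfolding edges_tilde_hypercube by blast
    then have "length (a # u) = Suc n" "tilde_step (a # u) (a # v)" "e = {a # u, a # v}"
      using 1(2) by (auto simp: tilde_step_Cons_iff)
    then show ?thesis unfolding edges_tilde_hypercube by blast
  next
    case (2 u)
    then have "length (False # u) = Suc n" "tilde_step (False # u) (True # u)"
      by (auto simp: tilde_step_Cons_iff)
    with 2(2) show ?thesis unfolding edges_tilde_hypercube by blast
  next
    case (3 x)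
    then have "length (False # True # x) = Suc n"
      "tilde_step (False # True # x) (True # False # x)"
      by (auto simp: tilde_step_Cons_iff)
    with 3(2) show ?thesis unfolding edges_tilde_hypercube by blast
  qed
qed

lemma card_words: "card {u :: word. length u = n} = 2 ^ n"
  using card_lists_length_eq[of "UNIV :: bool set" n] by simp

lemma finite_words: "finite {u :: word. length u = n}"
  using finite_lists_length_eq[of "UNIV :: bool set" n] by simp

lemma finite_edges_tilde_hypercube: "finite (edges (tilde_hypercube n))"
proof (rule finite_subset)
  show "edges (tilde_hypercube n) \<subseteq> Pow {u. length u = n}"
    by (auto simp: tilde_hypercube_def)
qed (simp add: finite_words)

text \<open>The four families are pairwise disjoint and each is parametrised injectively, so their
  cardinalities add up.\<close>

lemma card_edges_tilde_hypercube_Suc: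
  "card (edges (tilde_hypercube (Suc n))) =
    2 * card (edges (tilde_hypercube n)) + 2 ^ n + card {x :: word. Suc (length x) = n}"
proof -
  let ?E = "edges (tilde_hypercube n)"
  let ?A = "\<lambda>a. (`) (Cons a) ` ?E"
  let ?B = "(\<lambda>u. {False # u, True # u}) ` {u. length u = n}"
  let ?C = "(\<lambda>x. {False # True # x, True # False # x}) ` {x. Suc (length x) = n}"
  have fin: "finite {x :: word. Suc (length x) = n}"
    by (cases n) (simp_all add: finite_words)
  have ne: "e \<noteq> {}" if "e \<in> ?E" for e
    using that unfolding edges_tilde_hypercube by blast
  have A: "card (?A a) = card ?E" for a
    by (intro card_image inj_onI) (simp add: inj_image_eq_iff)
  have B: "card ?B = 2 ^ n"
    by (subst card_image) (auto simp: inj_on_def doubleton_eq_iff card_words)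
  have C: "card ?C = card {x :: word. Suc (length x) = n}"
    by (intro card_image) (auto simp: inj_on_def doubleton_eq_iff)
  have heads: "Cons a ` e \<noteq> {False # u, True # v}" for a e and u v :: word
  proof
    assume "Cons a ` e = {False # u, True # v}"
    then have "False # u \<in> Cons a ` e" "True # v \<in> Cons a ` e" by simp_all
    then show False by auto
  qed
  \<comment> \<open>Nonemptiness of \<open>d\<close> matters: the two images of the empty set
    coincide.\<close>
  have tails: "Cons False ` d \<noteq> Cons True ` e" if d: "d \<in> ?E" for d e
  proof
    assume eq: "Cons False ` d = Cons True ` e"
    obtain u where "u \<in> d" using ne[OF d] by blast
    then have "False # u \<in> Cons True ` e" by (simp flip: eq)
    then show False by auto
  qed
  have "?A False \<inter> ?A True = {}"
    by (intro equals0I; elim IntE imageE) (simp add: tails)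
  moreover have "(?A False \<union> ?A True) \<inter> ?B = {}"
    by (intro equals0I; elim IntE UnE imageE) (simp_all add: heads)
  moreover have "(?A False \<union> ?A True \<union> ?B) \<inter> ?C = {}"
  proof -
    \<comment> \<open>The two words of an edge in \<open>?B\<close> have equal tails; in
      \<open>?C\<close> the tails differ in their first letter.\<close>
    have "?B \<inter> ?C = {}"
      by (intro equals0I; elim IntE imageE) (simp add: doubleton_eq_iff)
    moreover have "(?A False \<union> ?A True) \<inter> ?C = {}"
      by (intro equals0I; elim IntE UnE imageE) (simp_all add: heads)
    ultimately show ?thesis by (simp only: Int_Un_distrib2[of _ ?B] Un_empty)
  qed
  ultimately show ?thesis
    unfolding edges_tilde_hypercube_Suc
    by (simp add: card_Un_disjoint finite_edges_tilde_hypercube finite_words fin A B C)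
qed

text \<open>With order \<open>Suc n\<close> the factor \<open>3 * (n + 1) - 1\<close> becomes
  \<open>3 * n + 2\<close>, free of subtraction.\<close>

lemma card_edges_tilde_hypercube:
  "4 * int (card (edges (tilde_hypercube (Suc n)))) = (3 * int n + 2) * 2 ^ Suc n"
proof (induction n)
  case 0
  \<comment> \<open>Order 0 has no edges and the swap family is empty, so only the summand
    \<open>2 ^ 0\<close> remains.\<close>
  then show ?case by (simp add: card_edges_tilde_hypercube_Suc edges_tilde_hypercube_0)
next
  case (Suc n)
  then show ?case
    by (subst card_edges_tilde_hypercube_Suc) (simp add: card_words algebra_simps)
qed

theorem mainTheorem6:
  fixes n :: nat
  assumes "n \<ge> 1"
  shows "4 * int (card (edges (tilde_hypercube n))) = (3 * int n - 1) * 2 ^ n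
    \<and> real (card (edges (tilde_hypercube n))) = (3 * real n - 1) * 2 powi (int n - 2)"
proof
  obtain m where m: "n = Suc m" using assms by (cases n) auto
  show int: "4 * int (card (edges (tilde_hypercube n))) = (3 * int n - 1) * 2 ^ n"
    using card_edges_tilde_hypercube[of m] by (simp add: m algebra_simps)
  from arg_cong[OF int, of real_of_int]
  have "4 * real (card (edges (tilde_hypercube n))) = (3 * real n - 1) * 2 ^ n"
    by simp
  \<comment> \<open>For \<open>n = 1\<close> the exponent is -1, so the power is taken with an
    integer exponent and rewritten as a quotient.\<close>
  moreover have powi: "(2 :: real) powi (int n - 2) = 2 ^ n / 4"
    by (simp add: power_int_diff)
  ultimately show "real (card (edges (tilde_hypercube n)))
      = (3 * real n - 1) * 2 powi (int n - 2)"
    unfolding powi by simp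
qed

end
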